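(* Let $\alpha_0=\frac{1+\sqrt5}{2}$ and let $$f_0(x)=\frac{\sqrt5+1}{\sqrt5+\sqrt{5-\frac{4}{x^2}}}.$$ 1. Let $\alpha$ be an irrational real number. Then there exists an increasing (infinite) sequence of positive integers $q_n$ such that for every $n$ $$\lim_{t\to q_n-} t\cdot\psi_\alpha(t)\ \ge\ f_0(q_n).$$ 2. Let $\alpha$ be an irrational real number. The two conditions a) $t\,\psi_\alpha(t)<f_0(t)$ for all $t$ large enough; b) there exists an increasing (infinite) sequence of positive integers $q_n$ such that $\lim\limits_{t\to q_n-}\frac{t\,\psi_\alpha(t)}{f_0(t)}=1$ for every $n$; are satisfied simultaneously if and only if $\alpha=\alpha_0+C$ or $\alpha=-\alpha_0+C$ for some $C\in\mathbb{Z}$.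
   Context: For an irrational real number $\alpha$ and real $t\ge 1$, the irrationality measure function is $\psi_\alpha(t)=\min_{q\in\mathbb{Z},\,1\le q\le t}\|q\alpha\|$, where $\|\xi\|=\min_{a\in\mathbb{Z}}|\xi-a|$ is the distance to the nearest integer. The symbol $\lim_{t\to q-}$ denotes the left-hand limit at $q$ (so $q\ge 2$ is understood). *)

theory Defs
  imports Complex_Main
begin

definition dist_nearest_int :: "real \<Rightarrow> real" where
  "dist_nearest_int x = (INF a::int. \<bar>x - of_int a\<bar>)"

text \<open>The infimum is attained, so it is the minimum over the integers.\<close>

lemma dist_nearest_int_round: "dist_nearest_int x = \<bar>x - of_int (round x)\<bar>"
  unfolding dist_nearest_int_def
  by (rule cInf_eq_minimum) (auto intro: round_diff_minimal)

text \<open>Only meaningful for \<open>t \<ge> 1\<close>; otherwise the minimum is over the empty set.\<close>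

definition irrationality_measure_fun :: "real \<Rightarrow> real \<Rightarrow> real" where
  "irrationality_measure_fun \<alpha> t =
     Min ((\<lambda>q::int. dist_nearest_int (of_int q * \<alpha>)) ` {1..\<lfloor>t\<rfloor>})"

definition alpha0 :: real where
  "alpha0 = (1 + sqrt 5) / 2"

definition f0 :: "real \<Rightarrow> real" where
  "f0 x = (sqrt 5 + 1) / (sqrt 5 + sqrt (5 - 4 / x\<^sup>2))"

end

theory Submission
  imports Defs "HOL-Library.Infinite_Set"
begin

text \<open>Let \<open>q\<^sub>k\<close> be the convergent denominators of \<open>\<alpha>\<close> and \<open>\<xi>\<^sub>k = \<parallel>q\<^sub>k \<alpha>\<parallel>\<close>. The measure function is
  \<open>\<xi>\<^sub>k\<close> on \<open>[q\<^sub>k, q\<^bsub>k+1\<^esub>)\<close>, and \<open>q\<^bsub>k+1\<^esub> \<xi>\<^sub>k + q\<^sub>k \<xi>\<^bsub>k+1\<^esub> = 1\<close>, so the left limit at \<open>q\<^bsub>k+1\<^esub>\<close> is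
  \<open>1 / (1 + r s)\<close> with \<open>r = q\<^sub>k / q\<^bsub>k+1\<^esub>\<close> and \<open>s = \<xi>\<^bsub>k+1\<^esub> / \<xi>\<^sub>k\<close>. On the other hand
  \<open>f0 x = 1 / (1 + g D0 x)\<close>, where \<open>g = (\<surd>5 - 1) / 2\<close> and \<open>D0 x\<close> is the positive root of
  \<open>u\<^sup>2 + u = 1 - 1 / x\<^sup>2\<close>. A partial quotient at least 2 makes \<open>r s\<close> smaller than \<open>g D0\<close> by a fixed
  margin at one of two neighbouring indices. If there are only finitely many of these, then
  eventually \<open>s = g\<close>, and \<open>r \<le> D0 q\<^bsub>k+1\<^esub>\<close> means that the integer
  \<open>q\<^bsub>k+1\<^esub>\<^sup>2 - q\<^bsub>k+1\<^esub> q\<^sub>k - q\<^sub>k\<^sup>2\<close>, which is nonzero and alternates in sign, is at least 1. Equality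
  forces it to be 1, and then \<open>\<alpha> \<plusminus> g\<close> is an integer.\<close>

section \<open>Continued fractions\<close>

text \<open>The indices are shifted by one: \<open>cf_den \<alpha> (Suc k)\<close> and \<open>cf_num \<alpha> (Suc k)\<close> are the usual
  \<open>q\<^sub>k\<close> and \<open>p\<^sub>k\<close>, while \<open>cf_quot \<alpha> k\<close> is the usual partial quotient \<open>a\<^bsub>k+1\<^esub>\<close>.\<close>

primrec cf_rem :: "real \<Rightarrow> nat \<Rightarrow> real" where
  "cf_rem \<alpha> 0 = frac \<alpha>"
| "cf_rem \<alpha> (Suc k) = frac (1 / cf_rem \<alpha> k)"

definition cf_quot :: "real \<Rightarrow> nat \<Rightarrow> int" where
  "cf_quot \<alpha> k = \<lfloor>1 / cf_rem \<alpha> k\<rfloor>"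

fun cf_den :: "real \<Rightarrow> nat \<Rightarrow> int" where
  "cf_den \<alpha> 0 = 0"
| "cf_den \<alpha> (Suc 0) = 1"
| "cf_den \<alpha> (Suc (Suc k)) = cf_quot \<alpha> k * cf_den \<alpha> (Suc k) + cf_den \<alpha> k"

fun cf_num :: "real \<Rightarrow> nat \<Rightarrow> int" where
  "cf_num \<alpha> 0 = 1"
| "cf_num \<alpha> (Suc 0) = \<lfloor>\<alpha>\<rfloor>"
| "cf_num \<alpha> (Suc (Suc k)) = cf_quot \<alpha> k * cf_num \<alpha> (Suc k) + cf_num \<alpha> k"

text \<open>Up to the index shift this is the error \<open>\<xi>\<close>: \<open>cf_err_eq\<close>
  identifies it with the absolute value of
  \<open>cf_den \<alpha> k * \<alpha> - cf_num \<alpha> k\<close>. As a product it is visibly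
  positive and has \<open>cf_rem\<close> as the ratio of neighbours.\<close>

definition cf_err :: "real \<Rightarrow> nat \<Rightarrow> real" where
  "cf_err \<alpha> k = (\<Prod>i<k. cf_rem \<alpha> i)"

lemma cf_err_0 [simp]: "cf_err \<alpha> 0 = 1"
  and cf_err_Suc: "cf_err \<alpha> (Suc k) = cf_err \<alpha> k * cf_rem \<alpha> k"
  by (simp_all add: cf_err_def)

lemma frac_irrational: "x \<notin> \<rat> \<Longrightarrow> frac x \<notin> \<rat>"
  using Rats_add[of "frac x" "of_int \<lfloor>x\<rfloor>"] by (auto simp: frac_def)

lemma cf_rem_irrational:
  assumes "\<alpha> \<notin> \<rat>" shows "cf_rem \<alpha> k \<notin> \<rat>"
proof (induction k)
  case 0
  then show ?case using assms by (simp add: frac_irrational)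
next
  case (Suc k)
  then have "1 / cf_rem \<alpha> k \<notin> \<rat>"
    using Rats_inverse[of "1 / cf_rem \<alpha> k"] by auto
  then show ?case by (simp add: frac_irrational)
qed

lemma cf_rem_bounds:
  assumes "\<alpha> \<notin> \<rat>" shows "0 < cf_rem \<alpha> k" "cf_rem \<alpha> k < 1"
proof -
  have "cf_rem \<alpha> k \<noteq> 0" using cf_rem_irrational[OF assms, of k] by (metis Rats_0)
  moreover have "0 \<le> cf_rem \<alpha> k" by (cases k) simp_all
  ultimately show "0 < cf_rem \<alpha> k" by simp
  show "cf_rem \<alpha> k < 1" by (cases k) (simp_all add: frac_lt_1)
qed

lemma inverse_cf_rem: "1 / cf_rem \<alpha> k = of_int (cf_quot \<alpha> k) + cf_rem \<alpha> (Suc k)"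
  by (simp add: cf_quot_def frac_def)

lemma cf_rem_eq:
  assumes "\<alpha> \<notin> \<rat>" shows "cf_rem \<alpha> k = 1 / (of_int (cf_quot \<alpha> k) + cf_rem \<alpha> (Suc k))"
  unfolding inverse_cf_rem[symmetric] by simp

lemma cf_quot_ge_1:
  assumes "\<alpha> \<notin> \<rat>" shows "1 \<le> cf_quot \<alpha> k"
  using cf_rem_bounds[OF assms, of k] by (simp add: cf_quot_def le_floor_iff)

lemma cf_err_pos:
  assumes "\<alpha> \<notin> \<rat>" shows "0 < cf_err \<alpha> k"
  unfolding cf_err_def by (intro prod_pos) (simp add: cf_rem_bounds[OF assms])

text \<open>Clearing the denominator in \<open>inverse_cf_rem\<close> yields the recurrence of the
  convergents with the quotient's sign reversed, hence the alternating sign in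
  \<open>cf_err_eq\<close>.\<close>

lemma cf_err_Suc_Suc:
  assumes "\<alpha> \<notin> \<rat>"
  shows "cf_err \<alpha> (Suc (Suc k)) = cf_err \<alpha> k - of_int (cf_quot \<alpha> k) * cf_err \<alpha> (Suc k)"
proof -
  have "cf_rem \<alpha> k * cf_rem \<alpha> (Suc k) = 1 - of_int (cf_quot \<alpha> k) * cf_rem \<alpha> k"
    using inverse_cf_rem[of \<alpha> k] cf_rem_bounds[OF assms, of k]
    by (simp add: field_simps del: cf_rem.simps)
  then show ?thesis
    unfolding cf_err_Suc mult.assoc by (simp only:) (simp add: algebra_simps del: cf_rem.simps)
qed

lemma cf_err_eq:
  assumes "\<alpha> \<notin> \<rat>"
  shows "of_int (cf_den \<alpha> k) * \<alpha> - of_int (cf_num \<alpha> k) = (-1) ^ Suc k * cf_err \<alpha> k"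
proof (induction k rule: induct_nat_012)
  case 1
  then show ?case by (simp add: cf_err_Suc frac_def)
next
  case (ge2 k)
  have "of_int (cf_den \<alpha> (Suc (Suc k))) * \<alpha> - of_int (cf_num \<alpha> (Suc (Suc k)))
    = of_int (cf_quot \<alpha> k) * (of_int (cf_den \<alpha> (Suc k)) * \<alpha> - of_int (cf_num \<alpha> (Suc k)))
      + (of_int (cf_den \<alpha> k) * \<alpha> - of_int (cf_num \<alpha> k))"
    by (simp add: algebra_simps)
  also have "\<dots> = (-1) ^ Suc (Suc (Suc k)) * cf_err \<alpha> (Suc (Suc k))"
    unfolding ge2 cf_err_Suc_Suc[OF assms] by (simp add: algebra_simps)
  finally show ?case .
qed simp

lemma cf_det:
  "cf_num \<alpha> k * cf_den \<alpha> (Suc k) - cf_num \<alpha> (Suc k) * cf_den \<alpha> k = (-1) ^ k"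
  by (induction k) (simp_all add: algebra_simps)

text \<open>Inserting the two recurrences cancels the quotient terms, so the sum is independent of
  \<open>k\<close>.\<close>

lemma cf_den_err:
  assumes "\<alpha> \<notin> \<rat>"
  shows "of_int (cf_den \<alpha> (Suc k)) * cf_err \<alpha> k + of_int (cf_den \<alpha> k) * cf_err \<alpha> (Suc k) = 1"
proof (induction k)
  case (Suc k)
  then show ?case by (simp add: cf_err_Suc_Suc[OF assms] algebra_simps)
qed simp

lemma cf_den_nonneg:
  assumes "\<alpha> \<notin> \<rat>" shows "0 \<le> cf_den \<alpha> k"
proof (induction k rule: induct_nat_012)
  case (ge2 k)
  then show ?case using cf_quot_ge_1[OF assms, of k] by simp
qed simp_all

lemma cf_den_step:
  assumes "\<alpha> \<notin> \<rat>" shows "cf_den \<alpha> (Suc k) + cf_den \<alpha> k \<le> cf_den \<alpha> (Suc (Suc k))"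
  using mult_right_mono[OF cf_quot_ge_1[OF assms, of k] cf_den_nonneg[OF assms, of "Suc k"]]
  by simp

lemma cf_den_pos:
  assumes "\<alpha> \<notin> \<rat>" shows "1 \<le> cf_den \<alpha> (Suc k)"
proof (induction k)
  case (Suc k)
  then show ?case using cf_den_step[OF assms, of k] cf_den_nonneg[OF assms, of k] by linarith
qed simp

lemma cf_den_mono:
  assumes "\<alpha> \<notin> \<rat>" shows "cf_den \<alpha> k \<le> cf_den \<alpha> (Suc k)"
proof (cases k)
  case (Suc j)
  then show ?thesis using cf_den_step[OF assms, of j] cf_den_nonneg[OF assms, of j] by simp
qed simp

text \<open>Strict growth is claimed only from index 2 on: indices 1 and 2 both carry the value 1
  when the first partial quotient is 1.\<close>

lemma cf_den_strict_mono:
  assumes "\<alpha> \<notin> \<rat>" shows "cf_den \<alpha> (Suc (Suc k)) < cf_den \<alpha> (Suc (Suc (Suc k)))"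
  using cf_den_step[OF assms, of "Suc k"] cf_den_pos[OF assms, of k] by linarith

lemma cf_den_ge:
  assumes "\<alpha> \<notin> \<rat>" shows "int k \<le> cf_den \<alpha> (Suc k)"
proof (induction k)
  case (Suc k)
  show ?case
  proof (cases k)
    case 0
    then show ?thesis using cf_den_pos[OF assms, of "Suc k"] by simp
  next
    case (Suc j)
    then show ?thesis using Suc.IH cf_den_strict_mono[OF assms, of j] by simp
  qed
qed simp

section \<open>The irrationality measure function\<close>

text \<open>Expand \<open>(m, n)\<close> in the unimodular basis of two consecutive convergents, with coordinates
  \<open>x, y\<close>. As \<open>0 < m < cf_den \<alpha> (Suc k)\<close>, the coordinates do not have the same sign, so the two
  contributions to \<open>m \<alpha> - n\<close> reinforce each other.\<close>

lemma best_approximation: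
  assumes "\<alpha> \<notin> \<rat>" and m: "1 \<le> m" "m < cf_den \<alpha> (Suc k)"
  shows "cf_err \<alpha> k \<le> \<bar>of_int m * \<alpha> - of_int n\<bar>"
proof -
  define q p q' p' where "q = cf_den \<alpha> k" and "p = cf_num \<alpha> k"
    and "q' = cf_den \<alpha> (Suc k)" and "p' = cf_num \<alpha> (Suc k)"
  define d :: int where "d = (-1) ^ k"
  \<comment> \<open>Cramer's rule; the determinant \<open>d\<close> is its own inverse.\<close>
  define x y where "x = d * (n * q' - m * p')" and "y = d * (m * p - n * q)"
  have d: "p * q' - p' * q = d" "d * d = 1" "\<bar>d\<bar> = 1"
    using cf_det[of \<alpha> k]
    by (simp_all add: p_def q_def p'_def q'_def d_def power_abs flip: power_mult_distrib)
  have "x * q + y * q' = d * (p * q' - p' * q) * m"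
    by (simp add: x_def y_def algebra_simps)
  then have mxy: "m = x * q + y * q'" by (simp add: d)
  have "x * p + y * p' = d * (p * q' - p' * q) * n"
    by (simp add: x_def y_def algebra_simps)
  then have nxy: "n = x * p + y * p'" by (simp add: d)
  have q0: "0 \<le> q" "1 \<le> q'"
    using cf_den_nonneg[OF assms(1), of k] cf_den_pos[OF assms(1), of k] by (simp_all add: q_def q'_def)
  note pos = cf_err_pos[OF assms(1), of k] cf_err_pos[OF assms(1), of "Suc k"]
  have "of_int m * \<alpha> - of_int n =
      of_int x * (of_int q * \<alpha> - of_int p) + of_int y * (of_int q' * \<alpha> - of_int p')"
    by (simp add: mxy nxy algebra_simps)
  also have "\<dots> = - (of_int d * (of_int x * cf_err \<alpha> k - of_int y * cf_err \<alpha> (Suc k)))"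
    unfolding q_def p_def q'_def p'_def cf_err_eq[OF assms(1)] by (simp add: d_def algebra_simps)
  finally have "\<bar>of_int m * \<alpha> - of_int n\<bar> = \<bar>of_int d\<bar> * \<bar>of_int x * cf_err \<alpha> k - of_int y * cf_err \<alpha> (Suc k)\<bar>"
    by (simp add: abs_mult)
  also have "\<bar>of_int d :: real\<bar> = 1" using d(3) by (metis of_int_1 of_int_abs)
  finally have eq: "\<bar>of_int m * \<alpha> - of_int n\<bar> = \<bar>of_int x * cf_err \<alpha> k - of_int y * cf_err \<alpha> (Suc k)\<bar>"
    by simp
  have mq: "m < q'" using m by (simp add: q'_def)
  consider "x \<ge> 1" "y \<le> 0" | "x \<le> -1" "y \<ge> 0"
  proof -
    \<comment> \<open>Otherwise \<open>m\<close> would be a multiple of \<open>q'\<close> strictly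
      between 0 and \<open>q'\<close>. A nonzero \<open>x\<close> contributes at least one full
      \<open>cf_err \<alpha> k\<close>.\<close>
    have "x \<noteq> 0"
    proof
      assume "x = 0"
      then have "0 < y * q'" "y * q' < 1 * q'" using m mq mxy by simp_all
      then have "0 < y" "y < 1" using q0 
        by (simp_all add: zero_less_mult_iff mult_less_cancel_right)
      then show False by simp
    qed
    moreover have "y \<le> 0" if "x \<ge> 1"
    proof (rule ccontr)
      assume "\<not> y \<le> 0"
      then have "0 \<le> x * q" "1 * q' \<le> y * q'" using that q0 by (auto intro!: mult_right_mono)
      then show False using mxy mq by simp
    qed
    moreover have "y \<ge> 0" if "x \<le> -1"
    proof (rule ccontr)
      assume "\<not> y \<ge> 0"
      then have "x * q \<le> 0" "y * q' \<le> 0" using that q0 by (auto intro!: mult_nonpos_nonneg)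
      then show False using mxy m by simp
    qed
    ultimately show ?thesis using that by linarith
  qed
  then show ?thesis
  proof cases
    case 1
    then have "1 * cf_err \<alpha> k \<le> of_int x * cf_err \<alpha> k" "of_int y * cf_err \<alpha> (Suc k) \<le> 0"
      using pos by (auto intro!: mult_right_mono mult_nonpos_nonneg)
    then show ?thesis unfolding eq by linarith
  next
    case 2
    then have "of_int x * cf_err \<alpha> k \<le> of_int (-1) * cf_err \<alpha> k" "0 \<le> of_int y * cf_err \<alpha> (Suc k)"
      using pos by (auto simp del: of_int_minus intro!: mult_right_mono mult_nonneg_nonneg)
    then show ?thesis unfolding eq by simp
  qed
qed

lemma dist_nearest_int_le: "dist_nearest_int x \<le> \<bar>x - of_int n\<bar>"
  unfolding dist_nearest_int_round by (rule round_diff_minimal)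

lemma dist_nearest_int_ge_cf_err:
  assumes "\<alpha> \<notin> \<rat>" "1 \<le> m" "m < cf_den \<alpha> (Suc k)"
  shows "cf_err \<alpha> k \<le> dist_nearest_int (of_int m * \<alpha>)"
  unfolding dist_nearest_int_round by (rule best_approximation[OF assms])

text \<open>Best approximation bounds every admissible denominator from below, and
  \<open>cf_den \<alpha> (Suc k)\<close>, already in range, attains the bound.\<close>

lemma irrationality_measure_fun_eq:
  assumes "\<alpha> \<notin> \<rat>" "of_int (cf_den \<alpha> (Suc k)) \<le> t" "t < of_int (cf_den \<alpha> (Suc (Suc k)))"
  shows "irrationality_measure_fun \<alpha> t = cf_err \<alpha> (Suc k)"
  unfolding irrationality_measure_fun_def
proof (rule Min_eqI)
  have less: "cf_den \<alpha> (Suc k) \<le> \<lfloor>t\<rfloor>" "\<lfloor>t\<rfloor> < cf_den \<alpha> (Suc (Suc k))"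
    using assms by (simp_all add: le_floor_iff floor_less_iff)
  show "cf_err \<alpha> (Suc k) \<le> y"
    if "y \<in> (\<lambda>q. dist_nearest_int (of_int q * \<alpha>)) ` {1..\<lfloor>t\<rfloor>}" for y
    using that less by (auto intro!: dist_nearest_int_ge_cf_err[OF assms(1)])
  have "dist_nearest_int (of_int (cf_den \<alpha> (Suc k)) * \<alpha>)
      \<le> \<bar>of_int (cf_den \<alpha> (Suc k)) * \<alpha> - of_int (cf_num \<alpha> (Suc k))\<bar>"
    by (rule dist_nearest_int_le)
  also have "\<dots> = cf_err \<alpha> (Suc k)"
    unfolding cf_err_eq[OF assms(1)] using cf_err_pos[OF assms(1), of "Suc k"]
    by (simp add: abs_mult power_abs)
  finally have "cf_err \<alpha> (Suc k) = dist_nearest_int (of_int (cf_den \<alpha> (Suc k)) * \<alpha>)"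
    using dist_nearest_int_ge_cf_err[OF assms(1) cf_den_pos[OF assms(1), of k], of "Suc k"] less
    by linarith
  then show "cf_err \<alpha> (Suc k) \<in> (\<lambda>q. dist_nearest_int (of_int q * \<alpha>)) ` {1..\<lfloor>t\<rfloor>}"
    using less cf_den_pos[OF assms(1), of k] by (intro image_eqI) auto
qed simp

lemma cf_den_interval:
  assumes "\<alpha> \<notin> \<rat>" "1 \<le> m"
  obtains k where "cf_den \<alpha> (Suc k) \<le> m" "m < cf_den \<alpha> (Suc (Suc k))"
proof -
  define P where "P j \<longleftrightarrow> m < cf_den \<alpha> j" for j
  have "P (Suc (nat (m + 1)))"
    using cf_den_ge[OF assms(1), of "nat (m + 1)"] assms(2) by (simp add: P_def)
  moreover have "\<not> P 0" "\<not> P (Suc 0)" using assms(2) by (simp_all add: P_def)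
  ultimately have L: "P (LEAST j. P j)" "(LEAST j. P j) \<noteq> 0" "(LEAST j. P j) \<noteq> Suc 0"
    by (metis LeastI)+
  then obtain k where k: "(LEAST j. P j) = Suc (Suc k)" by (metis not0_implies_Suc)
  then have "\<not> P (Suc k)" by (metis not_less_Least lessI)
  with L k show ?thesis by (intro that[of k]) (simp_all add: P_def)
qed

text \<open>Only the floor of \<open>t\<close> matters, and it is \<open>q - 1\<close> just left of
  \<open>q\<close>. So left limits at integers reduce to a single value.\<close>

lemma irrationality_measure_fun_at_left:
  fixes q :: nat
  shows "\<forall>\<^sub>F t in at_left (real q).
    irrationality_measure_fun \<alpha> t = irrationality_measure_fun \<alpha> (real q - 1)"
proof -
  have "\<forall>\<^sub>F t in at_left (real q). t \<in> {real q - 1<..<real q}"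
    by (rule eventually_at_left_real) simp
  then show ?thesis
  proof eventually_elim
    case (elim t)
    then have "\<lfloor>t\<rfloor> = int q - 1" by (simp add: floor_eq_iff)
    then show ?case by (simp add: irrationality_measure_fun_def)
  qed
qed

lemma tendsto_irrationality_measure_fun:
  fixes q :: nat
  shows "((\<lambda>t. t * irrationality_measure_fun \<alpha> t) \<longlongrightarrow>
    real q * irrationality_measure_fun \<alpha> (real q - 1)) (at_left (real q))"
proof (rule Lim_transform_eventually)
  show "((\<lambda>t. t * irrationality_measure_fun \<alpha> (real q - 1)) \<longlongrightarrow>
    real q * irrationality_measure_fun \<alpha> (real q - 1)) (at_left (real q))"
    by (intro tendsto_intros)
  show "\<forall>\<^sub>F t in at_left (real q). t * irrationality_measure_fun \<alpha> (real q - 1)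
    = t * irrationality_measure_fun \<alpha> t"
    using irrationality_measure_fun_at_left[of \<alpha> q] by eventually_elim simp
qed

section \<open>The function \<open>f0\<close>\<close>

definition D0 :: "real \<Rightarrow> real" where
  "D0 x = (sqrt (5 - 4 / x\<^sup>2) - 1) / 2"

text \<open>The reciprocal of the golden ratio, equal to \<open>alpha0 - 1\<close>; it is a fixed
  point of the Gauss map.\<close>

definition golden :: real where
  "golden = (sqrt 5 - 1) / 2"

lemma golden_square: "golden\<^sup>2 = 1 - golden"
  by (simp add: golden_def power2_eq_square field_simps)

lemma golden_bounds: "0.618 \<le> golden" "golden < 1"
proof -
  have "2.236 \<le> sqrt 5" by (rule real_le_rsqrt) (simp add: power2_eq_square)
  then show "0.618 \<le> golden" by (simp add: golden_def)
  have "sqrt 5 < 3" by (rule real_less_lsqrt) (simp_all add: power2_eq_square)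
  then show "golden < 1" by (simp add: golden_def)
qed

lemma golden_pos: "0 < golden"
  using golden_bounds(1) by simp

lemma alpha0_eq: "alpha0 = 1 + golden"
  by (simp add: alpha0_def golden_def field_simps)

lemma inverse_golden: "1 / golden = 1 + golden"
proof -
  have "golden * (1 + golden) = 1" using golden_square by (simp add: power2_eq_square algebra_simps)
  then show ?thesis using golden_bounds by (simp add: divide_eq_eq mult.commute)
qed

lemma sqrt_arg_ge_1:
  fixes x :: real assumes "1 \<le> x" shows "1 \<le> 5 - 4 / x\<^sup>2"
  using divide_left_mono[of 1 "x\<^sup>2" 4] assms by simp

lemma D0_nonneg:
  assumes "1 \<le> x" shows "0 \<le> D0 x"
  using sqrt_arg_ge_1[OF assms] by (simp add: D0_def)

lemma D0_quadratic:
  assumes "1 \<le> x" shows "(D0 x)\<^sup>2 + D0 x = 1 - 1 / x\<^sup>2"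
proof -
  have "(sqrt (5 - 4 / x\<^sup>2))\<^sup>2 = 5 - 4 / x\<^sup>2" using sqrt_arg_ge_1[OF assms] by simp
  then show ?thesis by (simp add: D0_def power2_eq_square field_simps)
qed

lemma f0_eq:
  assumes "1 \<le> x" shows "f0 x = 1 / (1 + golden * D0 x)"
proof -
  define w where "w = sqrt (5 - 4 / x\<^sup>2)"
  have w: "0 \<le> w" using sqrt_arg_ge_1[OF assms] by (simp add: w_def)
  \<comment> \<open>The cancellation rests on
    \<open>(sqrt 5 + 1) * (sqrt 5 - 1) = 4\<close>.\<close>
  have "(sqrt 5 + 1) * (1 + golden * D0 x) = sqrt 5 + w"
    unfolding golden_def D0_def w_def[symmetric] by (simp add: algebra_simps add_divide_distrib diff_divide_distrib)
  moreover have "0 < 1 + golden * D0 x"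
    using D0_nonneg[OF assms] golden_bounds by (simp add: add_pos_nonneg)
  moreover have "0 < sqrt 5 + w" using w by (simp add: add_pos_nonneg)
  ultimately show ?thesis unfolding f0_def w_def[symmetric] by (subst frac_eq_eq) auto
qed

lemma f0_pos:
  assumes "1 \<le> x" shows "0 < f0 x"
  using D0_nonneg[OF assms] golden_bounds by (simp add: f0_eq[OF assms] add_pos_nonneg)

lemma f0_antimono:
  assumes "1 \<le> x" "x \<le> y" shows "f0 y \<le> f0 x"
proof -
  have "4 / y\<^sup>2 \<le> 4 / x\<^sup>2" using assms by (intro divide_left_mono power_mono) auto
  then have "D0 x \<le> D0 y" by (simp add: D0_def)
  then have "golden * D0 x \<le> golden * D0 y" using golden_bounds by simp
  then show ?thesis using assms D0_nonneg[of x] D0_nonneg[of y] golden_pos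
    by (simp add: f0_eq) (intro divide_left_mono mult_pos_pos add_pos_nonneg; simp)
qed

lemma tendsto_f0:
  assumes "1 \<le> x" shows "(f0 \<longlongrightarrow> f0 x) (at_left x)"
proof -
  have "sqrt 5 + sqrt (5 - 4 / x\<^sup>2) \<noteq> 0"
    using sqrt_arg_ge_1[OF assms] by (simp add: add_nonneg_eq_0_iff)
  then show ?thesis using assms unfolding f0_def by (intro tendsto_intros) auto
qed

text \<open>The threshold lies between \<open>1 / 2.7\<close>, the largest product met in
  \<open>large_quotient\<close>, and the limit \<open>golden\<^sup>2\<close>, about 0.382.\<close>

lemma golden_D0_gt:
  assumes "7 \<le> x" shows "0.375 < golden * D0 x"
proof -
  have "1 / x\<^sup>2 \<le> 1 / 7\<^sup>2" using assms by (intro divide_left_mono power_mono) auto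
  then have "(D0 x)\<^sup>2 + D0 x \<ge> 1 - 1/49" using D0_quadratic[of x] assms by simp
  \<comment> \<open>The value 0.607 meets two needs: \<open>0.618 * 0.607\<close> exceeds 0.375, and
    \<open>0.607\<^sup>2 + 0.607\<close> is below \<open>48 / 49\<close>.\<close>
  moreover have "(D0 x)\<^sup>2 + D0 x < 1 - 1/49" if "D0 x < 0.607"
  proof -
    have "(D0 x)\<^sup>2 \<le> 0.607\<^sup>2" using that D0_nonneg[of x] assms by (intro power_mono) auto
    then show ?thesis using that by (simp add: power2_eq_square)
  qed
  ultimately have "0.607 \<le> D0 x" by force
  then have "0.618 * 0.607 \<le> golden * D0 x" using golden_bounds by (intro mult_mono) auto
  then show ?thesis by simp
qed

text \<open>For \<open>r = y / x\<close> the equation of \<open>D0\<close> turns comparisons into comparisons of the integral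
  quadratic form with 1.\<close>

lemma D0_le_iff:
  assumes "1 \<le> x" "0 \<le> y"
  shows "D0 x \<le> y / x \<longleftrightarrow> x\<^sup>2 - x * y - y\<^sup>2 \<le> 1" and "y / x \<le> D0 x \<longleftrightarrow> 1 \<le> x\<^sup>2 - x * y - y\<^sup>2"
proof -
  define F where "F = x\<^sup>2 - x * y - y\<^sup>2"
  \<comment> \<open>The positive cofactor in
    \<open>(r\<^sup>2 + r) - (d\<^sup>2 + d) = (r - d) * (r + d + 1)\<close> for
    \<open>r = y / x\<close> and \<open>d = D0 x\<close>; the sign of \<open>r - d\<close> is then
    that of \<open>1 - F\<close>.\<close>
  define v where "v = y / x + D0 x + 1"
  have "0 \<le> y / x" using assms by simp
  then have v: "0 < v" using D0_nonneg[OF assms(1)] by (simp add: v_def)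
  have x2: "0 < x\<^sup>2" using assms by simp
  have "y / x = y * x / x\<^sup>2" using assms by (simp add: power2_eq_square)
  moreover have "(y / x)\<^sup>2 = y\<^sup>2 / x\<^sup>2" by (rule power_divide)
  ultimately have "(y / x)\<^sup>2 + y / x = (y\<^sup>2 + y * x) / x\<^sup>2"
    by (simp only: add_divide_distrib)
  also have "\<dots> = (x\<^sup>2 - F) / x\<^sup>2" by (simp add: F_def mult.commute)
  also have "\<dots> = 1 - F / x\<^sup>2" using x2 by (simp add: diff_divide_distrib)
  also have "\<dots> = (1 - F) / x\<^sup>2 + ((D0 x)\<^sup>2 + D0 x)"
    unfolding D0_quadratic[OF assms(1)] by (simp add: diff_divide_distrib)
  finally have "(y / x)\<^sup>2 + y / x = (1 - F) / x\<^sup>2 + ((D0 x)\<^sup>2 + D0 x)" .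
  moreover have "(r - d) * (r + d + 1) = (r\<^sup>2 + r) - (d\<^sup>2 + d)" for r d :: real
    by (simp add: power2_eq_square algebra_simps)
  ultimately have eq: "(y / x - D0 x) * v = (1 - F) / x\<^sup>2"
    by (simp only: v_def)
  have "0 \<le> (y / x - D0 x) * v \<longleftrightarrow> 0 \<le> y / x - D0 x"
    and "(y / x - D0 x) * v \<le> 0 \<longleftrightarrow> y / x - D0 x \<le> 0"
    using v by (simp_all only: zero_le_mult_iff mult_le_0_iff) linarith+
  moreover have "0 \<le> (1 - F) / x\<^sup>2 \<longleftrightarrow> 0 \<le> 1 - F" "(1 - F) / x\<^sup>2 \<le> 0 \<longleftrightarrow> 1 - F \<le> 0"
    using x2 by (simp_all only: zero_le_divide_iff divide_le_0_iff) linarith+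
  ultimately show "D0 x \<le> y / x \<longleftrightarrow> x\<^sup>2 - x * y - y\<^sup>2 \<le> 1" "y / x \<le> D0 x \<longleftrightarrow> 1 \<le> x\<^sup>2 - x * y - y\<^sup>2"
    unfolding eq F_def by linarith+
qed

lemma f0_le_iff:
  assumes "1 \<le> x" "0 \<le> y"
  shows "f0 x \<le> 1 / (1 + y) \<longleftrightarrow> y \<le> golden * D0 x"
    and "1 / (1 + y) \<le> f0 x \<longleftrightarrow> golden * D0 x \<le> y"
proof -
  have "0 \<le> golden * D0 x" using D0_nonneg[OF assms(1)] golden_bounds by simp
  then have *: "0 < 1 + golden * D0 x" "0 < 1 + y" using assms by simp_all
  then show "f0 x \<le> 1 / (1 + y) \<longleftrightarrow> y \<le> golden * D0 x"
    and "1 / (1 + y) \<le> f0 x \<longleftrightarrow> golden * D0 x \<le> y"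
    unfolding f0_eq[OF assms(1)] by (simp_all add: divide_inverse)
qed

section \<open>Left limits at the convergent denominators\<close>

definition cf_ratio :: "real \<Rightarrow> nat \<Rightarrow> real" where
  "cf_ratio \<alpha> k = of_int (cf_den \<alpha> k) / of_int (cf_den \<alpha> (Suc k))"

text \<open>Where the denominators grow strictly, \<open>cf_left_lim_measure\<close> identifies this
  at positive indices with the left limit at \<open>cf_den \<alpha> (Suc k)\<close>.\<close>

definition cf_left_lim :: "real \<Rightarrow> nat \<Rightarrow> real" where
  "cf_left_lim \<alpha> k = of_int (cf_den \<alpha> (Suc k)) * cf_err \<alpha> k"

lemma cf_ratio_bounds:
  assumes "\<alpha> \<notin> \<rat>" shows "0 \<le> cf_ratio \<alpha> k" "cf_ratio \<alpha> k \<le> 1"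
  using cf_den_nonneg[OF assms, of k] cf_den_pos[OF assms, of k] cf_den_mono[OF assms, of k]
  by (simp_all add: cf_ratio_def divide_le_eq_1)

lemma cf_left_lim_eq:
  assumes "\<alpha> \<notin> \<rat>" shows "cf_left_lim \<alpha> k = 1 / (1 + cf_ratio \<alpha> k * cf_rem \<alpha> k)"
proof -
  have Q: "0 < real_of_int (cf_den \<alpha> (Suc k))" using cf_den_pos[OF assms, of k] by simp
  have "cf_left_lim \<alpha> k * (1 + cf_ratio \<alpha> k * cf_rem \<alpha> k) = 1"
    using cf_den_err[OF assms, of k] Q
    by (simp add: cf_left_lim_def cf_ratio_def cf_err_Suc distrib_left mult_ac)
  moreover have "0 \<le> cf_ratio \<alpha> k * cf_rem \<alpha> k"
    using cf_ratio_bounds[OF assms, of k] cf_rem_bounds[OF assms, of k] by simp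
  ultimately show ?thesis by (simp add: eq_divide_eq)
qed

lemma f0_le_cf_left_lim_iff:
  assumes "\<alpha> \<notin> \<rat>"
  shows "f0 (of_int (cf_den \<alpha> (Suc k))) \<le> cf_left_lim \<alpha> k \<longleftrightarrow>
      cf_ratio \<alpha> k * cf_rem \<alpha> k \<le> golden * D0 (of_int (cf_den \<alpha> (Suc k)))"
    and "cf_left_lim \<alpha> k \<le> f0 (of_int (cf_den \<alpha> (Suc k))) \<longleftrightarrow>
      golden * D0 (of_int (cf_den \<alpha> (Suc k))) \<le> cf_ratio \<alpha> k * cf_rem \<alpha> k"
proof -
  have "1 \<le> real_of_int (cf_den \<alpha> (Suc k))" using cf_den_pos[OF assms, of k] by simp
  moreover have "0 \<le> cf_ratio \<alpha> k * cf_rem \<alpha> k"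
    using cf_ratio_bounds[OF assms, of k] cf_rem_bounds[OF assms, of k] by simp
  ultimately show "f0 (of_int (cf_den \<alpha> (Suc k))) \<le> cf_left_lim \<alpha> k \<longleftrightarrow>
      cf_ratio \<alpha> k * cf_rem \<alpha> k \<le> golden * D0 (of_int (cf_den \<alpha> (Suc k)))"
    and "cf_left_lim \<alpha> k \<le> f0 (of_int (cf_den \<alpha> (Suc k))) \<longleftrightarrow>
      golden * D0 (of_int (cf_den \<alpha> (Suc k))) \<le> cf_ratio \<alpha> k * cf_rem \<alpha> k"
    unfolding cf_left_lim_eq[OF assms] by (simp_all only: f0_le_iff)
qed

lemma cf_left_lim_measure:
  assumes "\<alpha> \<notin> \<rat>" and less: "cf_den \<alpha> (Suc k) < cf_den \<alpha> (Suc (Suc k))"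
  shows "real (nat (cf_den \<alpha> (Suc (Suc k)))) *
      irrationality_measure_fun \<alpha> (real (nat (cf_den \<alpha> (Suc (Suc k)))) - 1) = cf_left_lim \<alpha> (Suc k)"
proof -
  have "0 < cf_den \<alpha> (Suc (Suc k))" using cf_den_pos[OF assms(1), of "Suc k"] by simp
  then have q: "real (nat (cf_den \<alpha> (Suc (Suc k)))) = of_int (cf_den \<alpha> (Suc (Suc k)))" by simp
  have "cf_den \<alpha> (Suc k) \<le> cf_den \<alpha> (Suc (Suc k)) - 1" using less by simp
  then have "of_int (cf_den \<alpha> (Suc k)) \<le> (of_int (cf_den \<alpha> (Suc (Suc k)) - 1) :: real)"
    by (simp only: of_int_le_iff)
  then have "irrationality_measure_fun \<alpha> (of_int (cf_den \<alpha> (Suc (Suc k))) - 1) = cf_err \<alpha> (Suc k)"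
    by (intro irrationality_measure_fun_eq[OF assms(1)]) simp_all
  then show ?thesis unfolding q cf_left_lim_def by simp
qed

lemma nat_cf_den_ge:
  assumes "\<alpha> \<notin> \<rat>" shows "k \<le> nat (cf_den \<alpha> (Suc k))"
  using cf_den_ge[OF assms, of k] by simp

text \<open>The margin comes from \<open>0.375 < golden\<^sup>2\<close>, the limit of \<open>golden * D0 x\<close>: if \<open>cf_rem \<alpha> (Suc k) > 0.7\<close>
  then \<open>cf_rem \<alpha> k < 1 / 2.7\<close>, otherwise \<open>cf_ratio \<alpha> (Suc k) \<le> 1 / 2\<close> gives a product at most \<open>0.35\<close>.\<close>

lemma large_quotient:
  assumes \<alpha>: "\<alpha> \<notin> \<rat>" and a: "2 \<le> cf_quot \<alpha> k" and "7 \<le> k"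
  obtains j where "k \<le> j" "f0 (of_int (cf_den \<alpha> (Suc j))) < cf_left_lim \<alpha> j"
proof -
  have D: "0.375 < golden * D0 (of_int (cf_den \<alpha> (Suc j)))" if "k \<le> j" for j
  proof (rule golden_D0_gt)
    have "7 \<le> cf_den \<alpha> (Suc j)" using cf_den_ge[OF \<alpha>, of j] that assms(3) by simp
    then show "7 \<le> real_of_int (cf_den \<alpha> (Suc j))" by simp
  qed
  have *: "f0 (of_int (cf_den \<alpha> (Suc j))) < cf_left_lim \<alpha> j"
    if "k \<le> j" "cf_ratio \<alpha> j * cf_rem \<alpha> j \<le> 0.375" for j
    using D[OF that(1)] that(2) f0_le_cf_left_lim_iff(2)[OF \<alpha>, of j] by linarith
  have a': "2 \<le> real_of_int (cf_quot \<alpha> k)" using a by simp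
  note r = cf_ratio_bounds[OF \<alpha>]
  note s = cf_rem_bounds[OF \<alpha>]
  show ?thesis
  proof (cases "cf_rem \<alpha> (Suc k) > 0.7")
    case True
    then have "cf_rem \<alpha> k \<le> 1 / 2.7"
      unfolding cf_rem_eq[OF \<alpha>, of k] using a' by (intro divide_left_mono) auto
    then have "cf_ratio \<alpha> k * cf_rem \<alpha> k \<le> 1 * (1 / 2.7)"
      using r[of k] s[of k] by (intro mult_mono) auto
    then show ?thesis by (intro that[of k] *) simp_all
  next
    case False
    have "2 * cf_den \<alpha> (Suc k) \<le> cf_quot \<alpha> k * cf_den \<alpha> (Suc k)"
      using a cf_den_nonneg[OF \<alpha>, of "Suc k"] by (intro mult_right_mono) auto
    then have "2 * cf_den \<alpha> (Suc k) \<le> cf_den \<alpha> (Suc (Suc k))"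
      using cf_den_nonneg[OF \<alpha>, of k] by simp
    then have "2 * real_of_int (cf_den \<alpha> (Suc k)) \<le> real_of_int (cf_den \<alpha> (Suc (Suc k)))" by linarith
    moreover have "0 < real_of_int (cf_den \<alpha> (Suc (Suc k)))"
      unfolding of_int_0_less_iff using cf_den_pos[OF \<alpha>, of "Suc k"] by linarith
    ultimately have "cf_ratio \<alpha> (Suc k) \<le> 1 / 2" by (simp add: cf_ratio_def divide_le_eq del: cf_den.simps)
    then have "cf_ratio \<alpha> (Suc k) * cf_rem \<alpha> (Suc k) \<le> 1 / 2 * 0.7"
      using r[of "Suc k"] s[of "Suc k"] False by (intro mult_mono) auto
    then show ?thesis by (intro that[of "Suc k"] *) simp_all
  qed
qed

section \<open>Tails with all partial quotients equal to 1\<close>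

text \<open>With quotient 1 the Gauss map expands distances from its fixed point
  \<open>golden\<close> by at least \<open>1 + golden\<close>, yet all remainders stay in the unit
  interval.\<close>

lemma cf_rem_eq_golden:
  assumes \<alpha>: "\<alpha> \<notin> \<rat>" and one: "\<And>j. k \<le> j \<Longrightarrow> cf_quot \<alpha> j = 1"
  shows "cf_rem \<alpha> k = golden"
proof (rule ccontr)
  assume "cf_rem \<alpha> k \<noteq> golden"
  then have pos: "0 < \<bar>cf_rem \<alpha> k - golden\<bar>" by simp
  note s = cf_rem_bounds[OF \<alpha>]
  have step: "(1 + golden) * \<bar>cf_rem \<alpha> j - golden\<bar> \<le> \<bar>cf_rem \<alpha> (Suc j) - golden\<bar>" if "k \<le> j" for j
  proof -
    have "cf_rem \<alpha> j * (1 + cf_rem \<alpha> (Suc j)) = 1"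
      using cf_rem_eq[OF \<alpha>, of j] s(1)[of "Suc j"] one[OF that]
      by (simp add: eq_divide_eq del: cf_rem.simps)
    moreover have "golden * (1 + golden) = 1"
      using golden_square by (simp add: power2_eq_square algebra_simps)
    moreover have "golden - u = (1 + v) * ((1 + golden) * (w - golden))"
      if "w * (1 + v) = 1" "golden * (1 + golden) = 1" "u = v" for u v w :: real
    proof -
      have "(1 + v) * ((1 + golden) * (w - golden))
          = (1 + golden) * (w * (1 + v)) - (1 + v) * (golden * (1 + golden))"
        by (simp add: algebra_simps)
      then show ?thesis unfolding that by simp
    qed
    ultimately have "golden - cf_rem \<alpha> (Suc j)
        = (1 + cf_rem \<alpha> (Suc j)) * ((1 + golden) * (cf_rem \<alpha> j - golden))" by blast
    then have "\<bar>golden - cf_rem \<alpha> (Suc j)\<bar>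
        = \<bar>1 + cf_rem \<alpha> (Suc j)\<bar> * (\<bar>1 + golden\<bar> * \<bar>cf_rem \<alpha> j - golden\<bar>)"
      by (simp only: abs_mult)
    moreover have "\<bar>1 + cf_rem \<alpha> (Suc j)\<bar> = 1 + cf_rem \<alpha> (Suc j)" "\<bar>1 + golden\<bar> = 1 + golden"
      using s(1)[of "Suc j"] golden_bounds by simp_all
    ultimately have "\<bar>cf_rem \<alpha> (Suc j) - golden\<bar>
        = (1 + cf_rem \<alpha> (Suc j)) * ((1 + golden) * \<bar>cf_rem \<alpha> j - golden\<bar>)"
      by (simp only: abs_minus_commute)
    moreover have "1 * ((1 + golden) * \<bar>cf_rem \<alpha> j - golden\<bar>)
        \<le> (1 + cf_rem \<alpha> (Suc j)) * ((1 + golden) * \<bar>cf_rem \<alpha> j - golden\<bar>)"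
      using s(1)[of "Suc j"] golden_bounds by (intro mult_right_mono) auto
    ultimately show ?thesis by simp
  qed
  have grow: "(1 + golden) ^ n * \<bar>cf_rem \<alpha> k - golden\<bar> \<le> \<bar>cf_rem \<alpha> (k + n) - golden\<bar>" for n
  proof (induction n)
    case (Suc n)
    then have "(1 + golden) * ((1 + golden) ^ n * \<bar>cf_rem \<alpha> k - golden\<bar>)
        \<le> (1 + golden) * \<bar>cf_rem \<alpha> (k + n) - golden\<bar>"
      using golden_bounds by (intro mult_left_mono) auto
    also have "\<dots> \<le> \<bar>cf_rem \<alpha> (Suc (k + n)) - golden\<bar>" by (rule step) simp
    finally show ?case by (simp add: mult.assoc)
  qed simp
  obtain n where "1 / \<bar>cf_rem \<alpha> k - golden\<bar> < (1 + golden) ^ n"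
    using real_arch_pow[of "1 + golden"] golden_bounds by auto
  then have "1 < (1 + golden) ^ n * \<bar>cf_rem \<alpha> k - golden\<bar>"
    using pos by (simp add: divide_less_eq)
  moreover have "\<bar>cf_rem \<alpha> (k + n) - golden\<bar> < 1"
    using s[of "k + n"] golden_pos golden_bounds(2) by linarith
  ultimately show False using grow[of n] by linarith
qed

section \<open>The quadratic form of consecutive denominators\<close>

text \<open>The norm of \<open>cf_den \<alpha> (Suc k) + cf_den \<alpha> k * golden\<close> in
  \<int>[golden].\<close>

definition cf_form :: "real \<Rightarrow> nat \<Rightarrow> int" where
  "cf_form \<alpha> k = (cf_den \<alpha> (Suc k))\<^sup>2 - cf_den \<alpha> (Suc k) * cf_den \<alpha> k - (cf_den \<alpha> k)\<^sup>2"

text \<open>A step with quotient 1 multiplies that element by \<open>1 + golden\<close>, a unit of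
  norm -1.\<close>

lemma cf_form_Suc:
  assumes "cf_quot \<alpha> k = 1" shows "cf_form \<alpha> (Suc k) = - cf_form \<alpha> k"
  using assms by (simp add: cf_form_def power2_eq_square algebra_simps)

lemma D0_cf_ratio_iff:
  assumes "\<alpha> \<notin> \<rat>"
  shows "D0 (of_int (cf_den \<alpha> (Suc k))) \<le> cf_ratio \<alpha> k \<longleftrightarrow> cf_form \<alpha> k \<le> 1"
    and "cf_ratio \<alpha> k \<le> D0 (of_int (cf_den \<alpha> (Suc k))) \<longleftrightarrow> 1 \<le> cf_form \<alpha> k"
proof -
  have form: "real_of_int (cf_form \<alpha> k) = (of_int (cf_den \<alpha> (Suc k)))\<^sup>2
      - of_int (cf_den \<alpha> (Suc k)) * of_int (cf_den \<alpha> k) - (of_int (cf_den \<alpha> k))\<^sup>2"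
    by (simp add: cf_form_def)
  have *: "1 \<le> real_of_int (cf_den \<alpha> (Suc k))" "0 \<le> real_of_int (cf_den \<alpha> k)"
    using cf_den_pos[OF assms, of k] cf_den_nonneg[OF assms, of k] by simp_all
  show "D0 (of_int (cf_den \<alpha> (Suc k))) \<le> cf_ratio \<alpha> k \<longleftrightarrow> cf_form \<alpha> k \<le> 1"
    and "cf_ratio \<alpha> k \<le> D0 (of_int (cf_den \<alpha> (Suc k))) \<longleftrightarrow> 1 \<le> cf_form \<alpha> k"
    unfolding cf_ratio_def D0_le_iff[OF *] form[symmetric] by simp_all
qed

text \<open>The factor \<open>golden\<close> cancels from both products, leaving
  \<open>cf_ratio\<close> against \<open>D0\<close>.\<close>

lemma f0_le_cf_left_lim_iff_form:
  assumes "\<alpha> \<notin> \<rat>" "cf_rem \<alpha> k = golden"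
  shows "f0 (of_int (cf_den \<alpha> (Suc k))) \<le> cf_left_lim \<alpha> k \<longleftrightarrow> 1 \<le> cf_form \<alpha> k"
    and "cf_left_lim \<alpha> k \<le> f0 (of_int (cf_den \<alpha> (Suc k))) \<longleftrightarrow> cf_form \<alpha> k \<le> 1"
proof -
  have *: "golden * a \<le> b * golden \<longleftrightarrow> a \<le> b" "b * golden \<le> golden * a \<longleftrightarrow> b \<le> a" for a b
    using golden_bounds by (simp_all add: mult.commute[of b])
  show "f0 (of_int (cf_den \<alpha> (Suc k))) \<le> cf_left_lim \<alpha> k \<longleftrightarrow> 1 \<le> cf_form \<alpha> k"
    and "cf_left_lim \<alpha> k \<le> f0 (of_int (cf_den \<alpha> (Suc k))) \<longleftrightarrow> cf_form \<alpha> k \<le> 1"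
    unfolding f0_le_cf_left_lim_iff[OF assms(1)] D0_cf_ratio_iff[OF assms(1), symmetric] assms(2)
    by (rule *)+
qed

text \<open>The form factors over \<int>[golden] with one positive factor, so a zero would make
  \<open>golden\<close> a quotient of integers.\<close>

lemma cf_form_nonzero:
  assumes "\<alpha> \<notin> \<rat>" "golden \<notin> \<rat>" shows "cf_form \<alpha> k \<noteq> 0"
proof
  assume 0: "cf_form \<alpha> k = 0"
  define x y where "x = real_of_int (cf_den \<alpha> (Suc k))" and "y = real_of_int (cf_den \<alpha> k)"
  have xy: "1 \<le> x" "0 \<le> y"
    using cf_den_pos[OF assms(1), of k] cf_den_nonneg[OF assms(1), of k] by (simp_all add: x_def y_def)
  have "real_of_int (cf_form \<alpha> k) = x\<^sup>2 - x * y - y\<^sup>2"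
    by (simp add: cf_form_def x_def y_def)
  also have "\<dots> = x\<^sup>2 * (golden\<^sup>2 + golden) - x * y - y\<^sup>2"
    by (simp add: golden_square)
  also have "\<dots> = (x * golden - y) * (x * golden + x + y)"
    by (simp add: power2_eq_square algebra_simps)
  finally have "(x * golden - y) * (x * golden + x + y) = 0" using 0 by simp
  moreover have "0 < x * golden + x + y" using xy golden_bounds by (simp add: add_pos_nonneg)
  ultimately have "golden = y / x" using xy by (simp add: eq_divide_eq mult.commute)
  then have "golden \<in> \<rat>" unfolding x_def y_def by (metis Rats_divide Rats_of_int)
  with assms(2) show False by simp
qed

text \<open>Either a quotient at least 2 occurs beyond \<open>max N 7\<close>, or the form is
  nonzero and alternates in sign from there on, so one of two neighbouring indices has a positive
  value.\<close>

lemma cf_left_lim_ge_f0_unbounded: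
  assumes \<alpha>: "\<alpha> \<notin> \<rat>"
  obtains k where "N \<le> k" "f0 (of_int (cf_den \<alpha> (Suc k))) \<le> cf_left_lim \<alpha> k"
proof (cases "\<exists>k\<ge>max N 7. 2 \<le> cf_quot \<alpha> k")
  case True
  then obtain k where "max N 7 \<le> k" "2 \<le> cf_quot \<alpha> k" by blast
  then show ?thesis using large_quotient[OF \<alpha>, of k] that
    by (metis less_imp_le max.boundedE order_trans)
next
  case False
  define K where "K = max N 7"
  have one: "cf_quot \<alpha> j = 1" if "K \<le> j" for j
    using False that cf_quot_ge_1[OF \<alpha>, of j] unfolding K_def by force
  have g: "cf_rem \<alpha> j = golden" if "K \<le> j" for j
    using that by (intro cf_rem_eq_golden[OF \<alpha>] one) simp
  \<comment> \<open>Irrationality is inherited from \<alpha>, since \<open>golden\<close> is one of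
    its remainders.\<close>
  then have "golden \<notin> \<rat>" using cf_rem_irrational[OF \<alpha>, of K] by simp
  then have "cf_form \<alpha> K \<noteq> 0" by (rule cf_form_nonzero[OF \<alpha>])
  then consider "1 \<le> cf_form \<alpha> K" | "1 \<le> cf_form \<alpha> (Suc K)"
    unfolding cf_form_Suc[OF one[OF order_refl]] by linarith
  then show ?thesis
  proof cases
    case 1
    then show ?thesis using f0_le_cf_left_lim_iff_form(1)[OF \<alpha> g[of K]] that[of K] by (simp add: K_def)
  next
    case 2
    then show ?thesis using f0_le_cf_left_lim_iff_form(1)[OF \<alpha> g[of "Suc K"]] that[of "Suc K"]
      by (simp add: K_def)
  qed
qed

text \<open>If the form takes the value 1 then \<open>x + y golden\<close> is a unit with inverse
  \<open>x - y - y golden\<close>, so the approximation errors are explicit elements of \<open>\<int>[golden]\<close>.\<close>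

lemma golden_shift_of_form_eq_1:
  assumes \<alpha>: "\<alpha> \<notin> \<rat>" and g: "cf_rem \<alpha> k = golden" and form: "cf_form \<alpha> k = 1"
  obtains C :: int where "\<alpha> = alpha0 + of_int C \<or> \<alpha> = - alpha0 + of_int C"
proof -
  define x y p' p where "x = cf_den \<alpha> (Suc k)" and "y = cf_den \<alpha> k"
    and "p' = cf_num \<alpha> (Suc k)" and "p = cf_num \<alpha> k"
  define \<sigma> :: int where "\<sigma> = (-1) ^ Suc k"
  define \<xi> where "\<xi> = cf_err \<alpha> k"
  have gg: "golden * golden = 1 - golden" using golden_square by (simp add: power2_eq_square)
  have F: "x * x - x * y - y * y = 1" using form by (simp add: cf_form_def x_def y_def power2_eq_square)
  then have "real_of_int (x * x - x * y - y * y) = 1" by simp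
  then have FR: "real_of_int x * of_int x - of_int x * of_int y - of_int y * of_int y = 1" by simp
  have unit: "\<xi> * (of_int x + of_int y * golden) = 1"
    using cf_den_err[OF \<alpha>, of k] by (simp add: x_def y_def \<xi>_def cf_err_Suc g algebra_simps)
  have "(of_int x + of_int y * golden) * (of_int x - of_int y - of_int y * golden)
      = of_int x * of_int x - of_int x * of_int y - of_int y * of_int y * (golden + golden * golden)"
    by (simp add: algebra_simps)
  also have "\<dots> = 1" using FR by (simp add: gg)
  finally have "\<xi> * ((of_int x + of_int y * golden) * (of_int x - of_int y - of_int y * golden)) = \<xi>"
    by simp
  then have \<xi>: "\<xi> = of_int x - of_int y - of_int y * golden"
    unfolding mult.assoc[symmetric] unit by simp
  have "\<xi> * golden = of_int x * golden - of_int y * golden - of_int y * (golden * golden)"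
    unfolding \<xi> by (simp add: algebra_simps)
  then have \<xi>': "\<xi> * golden = of_int x * golden - of_int y" by (simp add: gg algebra_simps)
  have e: "of_int y * \<alpha> - of_int p = of_int \<sigma> * \<xi>"
    "of_int x * \<alpha> - of_int p' = - of_int \<sigma> * (\<xi> * golden)"
    using cf_err_eq[OF \<alpha>, of k] cf_err_eq[OF \<alpha>, of "Suc k"]
    by (simp_all add: x_def y_def p_def p'_def \<sigma>_def \<xi>_def cf_err_Suc g)
  define \<beta> where "\<beta> = \<alpha> + of_int \<sigma> * golden"
  have M: "of_int y * \<beta> = of_int (p + \<sigma> * (x - y))" "of_int x * \<beta> = of_int (p' + \<sigma> * y)"
    using e unfolding \<xi>' unfolding \<xi> by (simp_all add: \<beta>_def algebra_simps)
  \<comment> \<open>The form being 1 is a Bezout relation for \<open>x\<close> and \<open>y\<close>,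
    so \<open>\<beta>\<close> is an integer because \<open>x * \<beta>\<close> and
    \<open>y * \<beta>\<close> are.\<close>
  have "\<beta> = (of_int x * of_int x - of_int x * of_int y - of_int y * of_int y) * \<beta>"
    unfolding FR by simp
  also have "\<dots> = (of_int x - of_int y) * (of_int x * \<beta>) - of_int y * (of_int y * \<beta>)"
    by (simp add: algebra_simps)
  also have "\<dots> = of_int ((x - y) * (p' + \<sigma> * y) - y * (p + \<sigma> * (x - y)))"
    unfolding M by simp
  finally obtain C :: int where "\<beta> = of_int C" by blast
  then have C: "\<alpha> = of_int C - of_int \<sigma> * golden" by (simp add: \<beta>_def algebra_simps)
  have "\<sigma> = 1 \<or> \<sigma> = -1" unfolding \<sigma>_def by (metis minus_one_power_iff)
  then show ?thesis
  proof
    assume "\<sigma> = 1"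
    \<comment> \<open>The witness differs from \<open>C\<close> by 1 because
      \<open>alpha0 = 1 + golden\<close>.\<close>
    then show ?thesis using C by (intro that[of "C + 1"]) (simp add: alpha0_eq)
  next
    assume "\<sigma> = -1"
    then show ?thesis using C by (intro that[of "C - 1"]) (simp add: alpha0_eq)
  qed
qed

section \<open>The golden ratio\<close>

lemma cf_rem_golden: "cf_rem golden k = golden"
proof (induction k)
  case 0
  then show ?case using golden_bounds by (simp add: frac_eq)
next
  case (Suc k)
  have "frac (1 + golden) = golden"
    using golden_bounds frac_1_eq[of golden] by (simp add: frac_eq add.commute)
  then show ?case using Suc by (simp add: inverse_golden)
qed

lemma cf_quot_golden: "cf_quot golden k = 1"
proof -
  have "\<lfloor>1 + golden\<rfloor> = 1" using golden_bounds by (simp add: floor_eq_iff)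
  then show ?thesis by (simp add: cf_quot_def cf_rem_golden inverse_golden)
qed

lemma cf_form_golden: "cf_form golden k = (-1) ^ k"
proof (induction k)
  case 0
  then show ?case by (simp add: cf_form_def)
next
  case (Suc k)
  then show ?case by (simp add: cf_form_Suc cf_quot_golden)
qed

section \<open>Invariance of the measure function under integer shifts and negation\<close>

lemma dist_nearest_int_add: "dist_nearest_int (x + of_int n) = dist_nearest_int x"
proof -
  have *: "dist_nearest_int (y + of_int m) \<le> dist_nearest_int y" for y m
    using dist_nearest_int_le[of "y + of_int m" "round y + m"] by (simp add: dist_nearest_int_round)
  show ?thesis using *[of x n] *[of "x + of_int n" "-n"] by simp
qed

lemma dist_nearest_int_minus: "dist_nearest_int (- x) = dist_nearest_int x"
proof -
  have *: "dist_nearest_int (- y) \<le> dist_nearest_int y" for y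
    using dist_nearest_int_le[of "- y" "- round y"] by (simp add: dist_nearest_int_round)
  show ?thesis using *[of x] *[of "- x"] by simp
qed

lemma irrationality_measure_fun_add:
  "irrationality_measure_fun (\<alpha> + of_int C) = irrationality_measure_fun \<alpha>"
proof -
  have "dist_nearest_int (of_int q * (\<alpha> + of_int C)) = dist_nearest_int (of_int q * \<alpha>)" for q
    using dist_nearest_int_add[of "of_int q * \<alpha>" "q * C"] by (simp add: distrib_left)
  then show ?thesis by (intro ext) (simp add: irrationality_measure_fun_def)
qed

lemma irrationality_measure_fun_minus:
  "irrationality_measure_fun (- \<alpha>) = irrationality_measure_fun \<alpha>"
  by (intro ext) (simp add: irrationality_measure_fun_def dist_nearest_int_minus)

lemma irrationality_measure_fun_golden:
  assumes "\<alpha> = alpha0 + of_int C \<or> \<alpha> = - alpha0 + of_int C"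
  shows "irrationality_measure_fun \<alpha> = irrationality_measure_fun golden"
proof -
  have "irrationality_measure_fun alpha0 = irrationality_measure_fun golden"
    using irrationality_measure_fun_add[of golden 1] by (simp add: alpha0_eq add.commute)
  then show ?thesis
    using assms by (metis irrationality_measure_fun_add irrationality_measure_fun_minus)
qed

lemma golden_irrational:
  assumes "\<alpha> \<notin> \<rat>" "\<alpha> = alpha0 + of_int C \<or> \<alpha> = - alpha0 + of_int C"
  shows "golden \<notin> \<rat>"
  using assms by (auto simp: alpha0_eq)

text \<open>Between consecutive denominators the product stays strictly below its left limit at the
  right end. The form is 1 or -1, so that limit is at most \<open>f0\<close> there, and
  \<open>f0\<close> is decreasing.\<close>

lemma golden_measure_lt_f0:
  assumes g: "golden \<notin> \<rat>" and t: "1 \<le> t"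
  shows "t * irrationality_measure_fun golden t < f0 t"
proof -
  have "1 \<le> \<lfloor>t\<rfloor>" using t by (simp add: le_floor_iff)
  then obtain k where k: "cf_den golden (Suc k) \<le> \<lfloor>t\<rfloor>" "\<lfloor>t\<rfloor> < cf_den golden (Suc (Suc k))"
    using cf_den_interval[OF g] by blast
  then have kt: "of_int (cf_den golden (Suc k)) \<le> t" "t < of_int (cf_den golden (Suc (Suc k)))"
    by (simp_all add: le_floor_iff floor_less_iff)
  have "t * irrationality_measure_fun golden t = t * cf_err golden (Suc k)"
    using irrationality_measure_fun_eq[OF g kt] by simp
  also have "\<dots> < cf_left_lim golden (Suc k)"
    unfolding cf_left_lim_def using kt(2) cf_err_pos[OF g] by (intro mult_strict_right_mono) auto
  also have "\<dots> \<le> f0 (of_int (cf_den golden (Suc (Suc k))))"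
    using f0_le_cf_left_lim_iff_form(2)[OF g cf_rem_golden, of "Suc k"]
    by (simp add: cf_form_golden minus_one_power_iff)
  also have "\<dots> \<le> f0 t" using t kt(2) by (intro f0_antimono) auto
  finally show ?thesis .
qed

section \<open>Sequences of left limits and the case of equality\<close>

lemma ex_strict_mono_seq:
  fixes P :: "nat \<Rightarrow> bool"
  assumes "\<And>N. \<exists>q\<ge>N. P q"
  shows "\<exists>q :: nat \<Rightarrow> nat. strict_mono q \<and> (\<forall>n. 2 \<le> q n) \<and> (\<forall>n. P (q n))"
proof -
  define S where "S = {q. 2 \<le> q \<and> P q}"
  have "infinite S"
    unfolding infinite_nat_iff_unbounded_le
  proof
    fix m
    obtain q where "max m 2 \<le> q" "P q" using assms by blast
    then show "\<exists>n\<ge>m. n \<in> S" by (auto simp: S_def)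
  qed
  then have "strict_mono (enumerate S)" "\<And>n. enumerate S n \<in> S"
    by (simp_all add: strict_mono_enumerate enumerate_in_set)
  then show ?thesis by (intro exI[of _ "enumerate S"]) (auto simp: S_def)
qed

lemma tendsto_measure_div_f0:
  fixes q :: nat assumes "1 \<le> q"
  shows "((\<lambda>t. t * irrationality_measure_fun \<alpha> t / f0 t) \<longlongrightarrow>
    real q * irrationality_measure_fun \<alpha> (real q - 1) / f0 (real q)) (at_left (real q))"
  using f0_pos[of "real q"] assms
  by (intro tendsto_divide tendsto_irrationality_measure_fun tendsto_f0) auto

text \<open>If \<open>q\<close> were not a convergent denominator, the measure function would not jump at \<open>q\<close>, and
  equality in the limit would contradict the strict inequality at \<open>t = q\<close>.\<close>

lemma cf_den_of_tendsto_1: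
  fixes q :: nat
  assumes \<alpha>: "\<alpha> \<notin> \<rat>" and q: "2 \<le> q"
    and less: "real q * irrationality_measure_fun \<alpha> (real q) < f0 (real q)"
    and lim: "((\<lambda>t. t * irrationality_measure_fun \<alpha> t / f0 t) \<longlongrightarrow> 1) (at_left (real q))"
  obtains k where "int q = cf_den \<alpha> (Suc k)" "cf_left_lim \<alpha> k = f0 (of_int (cf_den \<alpha> (Suc k)))"
proof -
  have "real q * irrationality_measure_fun \<alpha> (real q - 1) / f0 (real q) = 1"
    by (rule tendsto_unique[OF trivial_limit_at_left_real tendsto_measure_div_f0 lim]) (use q in simp)
  then have eq: "real q * irrationality_measure_fun \<alpha> (real q - 1) = f0 (real q)"
    unfolding divide_eq_1_iff by blast
  \<comment> \<open>The interval is located for \<open>q - 1\<close>, where the left limit is read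
    off; \<open>2 \<le> q\<close> keeps this point at least 1.\<close>
  obtain k where k: "cf_den \<alpha> (Suc k) \<le> int q - 1" "int q - 1 < cf_den \<alpha> (Suc (Suc k))"
    using cf_den_interval[OF \<alpha>, of "int q - 1"] q by auto
  have Q: "int q = cf_den \<alpha> (Suc (Suc k))"
  proof (rule ccontr)
    assume "int q \<noteq> cf_den \<alpha> (Suc (Suc k))"
    then have "int q < cf_den \<alpha> (Suc (Suc k))" using k by simp
    then have "real_of_int (int q) < of_int (cf_den \<alpha> (Suc (Suc k)))"
      by (simp only: of_int_less_iff)
    moreover have "of_int (cf_den \<alpha> (Suc k)) \<le> real_of_int (int q - 1)"
      using k(1) by (simp only: of_int_le_iff)
    ultimately have "irrationality_measure_fun \<alpha> (real q) = cf_err \<alpha> (Suc k)"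
      "irrationality_measure_fun \<alpha> (real q - 1) = cf_err \<alpha> (Suc k)"
      by (simp_all add: irrationality_measure_fun_eq[OF \<alpha>] del: cf_den.simps)
    then show False using eq less by simp
  qed
  then have "nat (cf_den \<alpha> (Suc (Suc k))) = q" by (metis nat_int)
  moreover have "cf_den \<alpha> (Suc k) < cf_den \<alpha> (Suc (Suc k))" using k(1) Q by linarith
  ultimately have "cf_left_lim \<alpha> (Suc k) = f0 (real q)"
    using cf_left_lim_measure[OF \<alpha>, of k] eq by metis
  moreover have "real q = of_int (cf_den \<alpha> (Suc (Suc k)))" unfolding Q[symmetric] by simp
  ultimately show ?thesis using Q by (intro that[of "Suc k"]) metis+
qed

text \<open>In the limit the strict inequality survives only as a weak one, which leaves room for
  equality in condition b).\<close>

lemma cf_left_lim_le_f0: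
  assumes \<alpha>: "\<alpha> \<notin> \<rat>"
    and ev: "\<forall>\<^sub>F t in at_top. t * irrationality_measure_fun \<alpha> t < f0 t"
  obtains K where "\<And>k. K \<le> k \<Longrightarrow> cf_left_lim \<alpha> k \<le> f0 (of_int (cf_den \<alpha> (Suc k)))"
proof -
  obtain T where T: "\<And>t. T \<le> t \<Longrightarrow> t * irrationality_measure_fun \<alpha> t < f0 t"
    using ev by (auto simp: eventually_at_top_linorder)
  \<comment> \<open>The two extra steps push the denominators strictly past \<open>T\<close> and
    give \<open>k\<close> the shape \<open>Suc (Suc j)\<close> for strict growth.\<close>
  define K where "K = Suc (Suc (nat \<lceil>T\<rceil>))"
  have "cf_left_lim \<alpha> k \<le> f0 (of_int (cf_den \<alpha> (Suc k)))" if k: "K \<le> k" for k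
  proof -
    have "k = Suc (Suc (k - 2))" using k by (simp add: K_def)
    then obtain j where j: "k = Suc (Suc j)" by blast
    define q where "q = nat (cf_den \<alpha> (Suc k))"
    have "K \<le> q" using nat_cf_den_ge[OF \<alpha>, of k] k by (simp add: q_def)
    then have q: "T < real q" "1 \<le> real q" by (auto simp: K_def) linarith
    have "\<forall>\<^sub>F t in at_left (real q). t \<in> {T<..<real q}"
      using q by (intro eventually_at_left_real)
    then have "\<forall>\<^sub>F t in at_left (real q). t * irrationality_measure_fun \<alpha> t \<le> f0 t"
      by eventually_elim (use T in \<open>auto intro: less_imp_le\<close>)
    then have "real q * irrationality_measure_fun \<alpha> (real q - 1) \<le> f0 (real q)"
      by (rule tendsto_le[OF trivial_limit_at_left_real tendsto_f0[OF q(2)]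
            tendsto_irrationality_measure_fun])
    moreover have "real q * irrationality_measure_fun \<alpha> (real q - 1) = cf_left_lim \<alpha> k"
      unfolding q_def j by (rule cf_left_lim_measure[OF \<alpha> cf_den_strict_mono[OF \<alpha>]])
    moreover have "real q = of_int (cf_den \<alpha> (Suc k))" using q(2) by (simp add: q_def)
    ultimately show ?thesis by simp
  qed
  then show ?thesis by (rule that)
qed

text \<open>Condition a) excludes quotients at least 2 far out, so the remainders become
  \<open>golden\<close>; a single far term of b) then forces the form to be 1.\<close>

lemma golden_shift_of_conditions:
  assumes \<alpha>: "\<alpha> \<notin> \<rat>"
    and ev: "\<forall>\<^sub>F t in at_top. t * irrationality_measure_fun \<alpha> t < f0 t"
    and q: "strict_mono (q :: nat \<Rightarrow> nat)" "\<And>n. 2 \<le> q n"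
    and lim: "\<And>n. ((\<lambda>t. t * irrationality_measure_fun \<alpha> t / f0 t) \<longlongrightarrow> 1) (at_left (real (q n)))"
  obtains C :: int where "\<alpha> = alpha0 + of_int C \<or> \<alpha> = - alpha0 + of_int C"
proof -
  obtain K where K: "\<And>k. K \<le> k \<Longrightarrow> cf_left_lim \<alpha> k \<le> f0 (of_int (cf_den \<alpha> (Suc k)))"
    using cf_left_lim_le_f0[OF \<alpha> ev] by blast
  obtain T where T: "\<And>t. T \<le> t \<Longrightarrow> t * irrationality_measure_fun \<alpha> t < f0 t"
    using ev by (auto simp: eventually_at_top_linorder)
  define K' where "K' = max K 7"
  have one: "cf_quot \<alpha> j = 1" if "K' \<le> j" for j
  proof (rule ccontr)
    assume "cf_quot \<alpha> j \<noteq> 1"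
    then have "2 \<le> cf_quot \<alpha> j" using cf_quot_ge_1[OF \<alpha>, of j] by simp
    moreover have "7 \<le> j" using that by (simp add: K'_def)
    ultimately obtain i where i: "j \<le> i" "f0 (of_int (cf_den \<alpha> (Suc i))) < cf_left_lim \<alpha> i"
      by (rule large_quotient[OF \<alpha>])
    then show False using K[of i] that by (simp add: K'_def)
  qed
  \<comment> \<open>Since \<open>n \<le> q n\<close>, a large index already places
    \<open>q n\<close> beyond both bounds.\<close>
  define n where "n = max (nat \<lceil>T\<rceil>) (nat (cf_den \<alpha> (Suc K')))"
  have n: "n \<le> q n" using q(1) by (rule strict_mono_imp_increasing)
  then have "nat \<lceil>T\<rceil> \<le> q n" by (simp add: n_def)
  then have "T \<le> real (q n)" by linarith
  then obtain k where k: "int (q n) = cf_den \<alpha> (Suc k)"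
      "cf_left_lim \<alpha> k = f0 (of_int (cf_den \<alpha> (Suc k)))"
    by (rule cf_den_of_tendsto_1[OF \<alpha> q(2)[of n] T lim[of n]])
  \<comment> \<open>A smaller \<open>k\<close> would give
    \<open>q n \<le> cf_den \<alpha> K' < cf_den \<alpha> (Suc K')\<close>, against the choice of
    \<open>n\<close>.\<close>
  have "K' \<le> k"
  proof (rule ccontr)
    assume "\<not> K' \<le> k"
    have mono: "cf_den \<alpha> i \<le> cf_den \<alpha> j" if "i \<le> j" for i j
      using that by (rule lift_Suc_mono_le[where f = "cf_den \<alpha>", rotated]) (rule cf_den_mono[OF \<alpha>])
    have "2 \<le> K'" by (simp add: K'_def)
    then obtain i where "K' = Suc (Suc i)" by (metis add_2_eq_Suc le_Suc_ex)
    then have "cf_den \<alpha> K' < cf_den \<alpha> (Suc K')" by (simp only: cf_den_strict_mono[OF \<alpha>])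
    moreover have "cf_den \<alpha> (Suc k) \<le> cf_den \<alpha> K'" using \<open>\<not> K' \<le> k\<close> by (intro mono) simp
    moreover have "nat (cf_den \<alpha> (Suc K')) \<le> q n" using n unfolding n_def by linarith
    then have "cf_den \<alpha> (Suc K') \<le> int (q n)" by linarith
    ultimately show False using k by simp
  qed
  then have g: "cf_rem \<alpha> k = golden" by (intro cf_rem_eq_golden[OF \<alpha>] one) simp
  have form: "cf_form \<alpha> k = 1"
    using f0_le_cf_left_lim_iff_form[OF \<alpha> g] k(2) by (metis order_refl order_antisym)
  show ?thesis by (rule golden_shift_of_form_eq_1[OF \<alpha> g form that])
qed

lemma golden_tendsto_1:
  assumes g: "golden \<notin> \<rat>"
  shows "\<exists>q\<ge>N. 2 \<le> q \<and>
    ((\<lambda>t. t * irrationality_measure_fun golden t / f0 t) \<longlongrightarrow> 1) (at_left (real q))"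
proof -
  \<comment> \<open>An odd \<open>k\<close> makes \<open>Suc k\<close> even, where the form is 1 and
    the left limit equals \<open>f0\<close> exactly.\<close>
  define k where "k = Suc (2 * N + 2)"
  define q where "q = nat (cf_den golden (Suc (Suc k)))"
  have "Suc k \<le> q" using nat_cf_den_ge[OF g, of "Suc k"] by (simp only: q_def)
  then have q: "N \<le> q" "2 \<le> q" by (simp_all add: k_def)
  have "cf_form golden (Suc k) = 1" by (simp add: cf_form_golden k_def)
  then have "cf_left_lim golden (Suc k) = f0 (of_int (cf_den golden (Suc (Suc k))))"
    using f0_le_cf_left_lim_iff_form[OF g cf_rem_golden, of "Suc k"] by simp
  moreover have "real q * irrationality_measure_fun golden (real q - 1) = cf_left_lim golden (Suc k)"
    unfolding q_def k_def by (intro cf_left_lim_measure[OF g]) (simp only: add_2_eq_Suc' cf_den_strict_mono[OF g])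
  moreover have "real q = of_int (cf_den golden (Suc (Suc k)))" using q by (simp add: q_def)
  ultimately have "real q * irrationality_measure_fun golden (real q - 1) = f0 (real q)" by simp
  then show ?thesis
    using tendsto_measure_div_f0[of q golden] f0_pos[of "real q"] q by auto
qed

theorem theorem1:
  fixes \<alpha> :: real
  assumes "\<alpha> \<notin> \<rat>"
  shows
    "(\<exists>q :: nat \<Rightarrow> nat. strict_mono q \<and> (\<forall>n. 2 \<le> q n) \<and>
        (\<forall>n. \<exists>L. ((\<lambda>t. t * irrationality_measure_fun \<alpha> t) \<longlongrightarrow> L) (at_left (real (q n)))
               \<and> L \<ge> f0 (real (q n))))
     \<and>
     (((\<forall>\<^sub>F t in at_top. t * irrationality_measure_fun \<alpha> t < f0 t) \<and>
       (\<exists>q :: nat \<Rightarrow> nat. strict_mono q \<and> (\<forall>n. 2 \<le> q n) \<and>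
          (\<forall>n. ((\<lambda>t. t * irrationality_measure_fun \<alpha> t / f0 t) \<longlongrightarrow> 1) (at_left (real (q n))))))
      \<longleftrightarrow> (\<exists>C::int. \<alpha> = alpha0 + of_int C \<or> \<alpha> = - alpha0 + of_int C))"
proof (intro conjI iffI)
  note \<alpha> = assms
  have "\<exists>q\<ge>N. \<exists>L. ((\<lambda>t. t * irrationality_measure_fun \<alpha> t) \<longlongrightarrow> L) (at_left (real q)) \<and> L \<ge> f0 (real q)"
    for N
  proof -
    \<comment> \<open>Asking for \<open>N + 2\<close> lets \<open>k\<close> be written as
      \<open>Suc (Suc j)\<close>, where the denominators grow strictly.\<close>
    obtain k where k: "N + 2 \<le> k" "f0 (of_int (cf_den \<alpha> (Suc k))) \<le> cf_left_lim \<alpha> k"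
      using cf_left_lim_ge_f0_unbounded[OF \<alpha>] by blast
    have "k = Suc (Suc (k - 2))" using k(1) by simp
    then obtain j where j: "k = Suc (Suc j)" by blast
    define q where "q = nat (cf_den \<alpha> (Suc k))"
    have "real q * irrationality_measure_fun \<alpha> (real q - 1) = cf_left_lim \<alpha> k"
      unfolding q_def j by (rule cf_left_lim_measure[OF \<alpha> cf_den_strict_mono[OF \<alpha>]])
    moreover have "real q = of_int (cf_den \<alpha> (Suc k))"
      using cf_den_pos[OF \<alpha>, of k] by (simp add: q_def)
    moreover have "N \<le> q" using nat_cf_den_ge[OF \<alpha>, of k] k(1) by (simp add: q_def)
    ultimately show ?thesis using k(2) tendsto_irrationality_measure_fun[of \<alpha> q] by metis
  qed
  then show "\<exists>q :: nat \<Rightarrow> nat. strict_mono q \<and> (\<forall>n. 2 \<le> q n) \<and>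
        (\<forall>n. \<exists>L. ((\<lambda>t. t * irrationality_measure_fun \<alpha> t) \<longlongrightarrow> L) (at_left (real (q n)))
               \<and> L \<ge> f0 (real (q n)))"
    by (rule ex_strict_mono_seq)
next
  assume "(\<forall>\<^sub>F t in at_top. t * irrationality_measure_fun \<alpha> t < f0 t) \<and>
       (\<exists>q :: nat \<Rightarrow> nat. strict_mono q \<and> (\<forall>n. 2 \<le> q n) \<and>
          (\<forall>n. ((\<lambda>t. t * irrationality_measure_fun \<alpha> t / f0 t) \<longlongrightarrow> 1) (at_left (real (q n)))))"
  then show "\<exists>C::int. \<alpha> = alpha0 + of_int C \<or> \<alpha> = - alpha0 + of_int C"
    using golden_shift_of_conditions[OF assms] by metis
next
  assume "\<exists>C::int. \<alpha> = alpha0 + of_int C \<or> \<alpha> = - alpha0 + of_int C"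
  then obtain C :: int where C: "\<alpha> = alpha0 + of_int C \<or> \<alpha> = - alpha0 + of_int C" by blast
  note eq = irrationality_measure_fun_golden[OF C]
  note g = golden_irrational[OF assms C]
  show "\<forall>\<^sub>F t in at_top. t * irrationality_measure_fun \<alpha> t < f0 t"
    unfolding eq using eventually_ge_at_top[of 1]
    by eventually_elim (rule golden_measure_lt_f0[OF g])
  show "\<exists>q :: nat \<Rightarrow> nat. strict_mono q \<and> (\<forall>n. 2 \<le> q n) \<and>
          (\<forall>n. ((\<lambda>t. t * irrationality_measure_fun \<alpha> t / f0 t) \<longlongrightarrow> 1) (at_left (real (q n))))"
    unfolding eq by (rule ex_strict_mono_seq) (use golden_tendsto_1[OF g] in blast)
qed

end
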